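(* The double category $\mathbb D\mathbf{TDX}$ has double products of small families of loose arrows. Precisely, let $(\mathcal Q_i,t_i):\mathcal A_i\rightsquigarrow\mathcal B_i$, $i\in I$, be a small family of 2-transducers, and define the 2-transducer $\big(\prod_i\mathcal Q_i,\ \prod_It_i\big):\prod_i\mathcal A_i\rightsquigarrow\prod_i\mathcal B_i$ by $$\Big(\prod_I t_i\Big)\big((a_i);(q_i),(q'_i)\big)[\underline b]=\prod_{i\in I}t_i(a_i;q_i,q'_i)[\pi_i^*\underline b],\qquad \underline b\in\Big(\prod_i\mathcal B_i\Big)^*.$$ Then there are cells $\prod_It_i\to t_i$ over the product projections such that every family of cells $(H_i,\theta_i)$ from a 2-transducer $(\mathcal P,s):\mathcal X\rightsquigarrow\mathcal Y$ to $(\mathcal Q_i,t_i)$ ($i\in I$) factors through them by a unique cell $(\hat H,\hat\theta):s\to\prod_It_i$.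
   Context: All categories are small. $\mathcal B^*$ is the free monoidal category on $\mathcal B$: objects are finite lists of objects, morphisms between lists of the same length are tuples of morphisms of $\mathcal B$, none between lists of different lengths; a functor $G:\mathcal B\to\mathcal B'$ induces $G^*:\mathcal B^*\to(\mathcal B')^*$. $\pi_i:\prod_j\mathcal B_j\to\mathcal B_i$ is the projection. A 2-transducer (loose arrow of $\mathbb D\mathbf{TDX}$) $(\mathcal Q,t):\mathcal A\rightsquigarrow\mathcal B$ is a category $\mathcal Q$ with a functor $t:\mathcal A\times\mathcal Q^{op}\times\mathcal Q\times(\mathcal B^* )^{op}\to\mathrm{Set}$, with values $t(a;q,q')[\underline b]$. Tight arrows are functors. A cell from $(\mathcal Q,s):\mathcal A\rightsquigarrow\mathcal B$ to $(\mathcal P,t):\mathcal A'\rightsquigarrow\mathcal B'$ over tight arrows $F:\mathcal A\to\mathcal A'$, $G:\mathcal B\to\mathcal B'$ is a pair $(U,\alpha)$ with $U:\mathcal Q\to\mathcal P$ a functor and $\alpha:s(a;q,q')[\underline b]\to t(Fa;Uq,Uq')[G^*\underline b]$ natural; cells compose vertically by composing functors and natural transformations. *)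

theory Defs
  imports Main "HOL-Library.FuncSet"
begin

section \<open>Small categories and functors\<close>

record ('o, 'm) cat =
  Obj :: "'o set"
  Arr :: "'m set"
  src :: "'m \<Rightarrow> 'o"
  tgt :: "'m \<Rightarrow> 'o"
  idn :: "'o \<Rightarrow> 'm"
  cmp :: "'m \<Rightarrow> 'm \<Rightarrow> 'm"

text \<open>\<open>cmp C g f\<close> is the composite \<open>g \<circ> f\<close>; it is meaningful only when \<open>src C g = tgt C f\<close>.\<close>

locale category =
  fixes C :: "('o, 'm) cat"
  assumes src_in: "f \<in> Arr C \<Longrightarrow> src C f \<in> Obj C"
    and tgt_in: "f \<in> Arr C \<Longrightarrow> tgt C f \<in> Obj C"
    and idn_in: "c \<in> Obj C \<Longrightarrow> idn C c \<in> Arr C"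
    and src_idn: "c \<in> Obj C \<Longrightarrow> src C (idn C c) = c"
    and tgt_idn: "c \<in> Obj C \<Longrightarrow> tgt C (idn C c) = c"
    and cmp_in: "\<lbrakk>f \<in> Arr C; g \<in> Arr C; src C g = tgt C f\<rbrakk> \<Longrightarrow> cmp C g f \<in> Arr C"
    and src_cmp: "\<lbrakk>f \<in> Arr C; g \<in> Arr C; src C g = tgt C f\<rbrakk> \<Longrightarrow> src C (cmp C g f) = src C f"
    and tgt_cmp: "\<lbrakk>f \<in> Arr C; g \<in> Arr C; src C g = tgt C f\<rbrakk> \<Longrightarrow> tgt C (cmp C g f) = tgt C g"
    and cmp_idn_right: "f \<in> Arr C \<Longrightarrow> cmp C f (idn C (src C f)) = f"
    and cmp_idn_left: "f \<in> Arr C \<Longrightarrow> cmp C (idn C (tgt C f)) f = f"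
    and cmp_assoc: "\<lbrakk>f \<in> Arr C; g \<in> Arr C; h \<in> Arr C; src C g = tgt C f; src C h = tgt C g\<rbrakk>
          \<Longrightarrow> cmp C h (cmp C g f) = cmp C (cmp C h g) f"

record ('o, 'm, 'p, 'n) fctr =
  onO :: "'o \<Rightarrow> 'p"
  onA :: "'m \<Rightarrow> 'n"

text \<open>Functors are extensional (\<open>undefined\<close> off their domain), so that equality of records is
  equality of functors.\<close>

locale cat_functor =
  fixes C :: "('o, 'm) cat" and D :: "('p, 'n) cat" and F :: "('o, 'm, 'p, 'n) fctr"
  assumes onO_in: "onO F \<in> Obj C \<rightarrow>\<^sub>E Obj D"
    and onA_in: "onA F \<in> Arr C \<rightarrow>\<^sub>E Arr D"
    and onA_src: "f \<in> Arr C \<Longrightarrow> src D (onA F f) = onO F (src C f)"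
    and onA_tgt: "f \<in> Arr C \<Longrightarrow> tgt D (onA F f) = onO F (tgt C f)"
    and onA_idn: "c \<in> Obj C \<Longrightarrow> onA F (idn C c) = idn D (onO F c)"
    and onA_cmp: "\<lbrakk>f \<in> Arr C; g \<in> Arr C; src C g = tgt C f\<rbrakk>
          \<Longrightarrow> onA F (cmp C g f) = cmp D (onA F g) (onA F f)"

definition fctr_comp ::
  "('o, 'm) cat \<Rightarrow> ('p, 'n, 'r, 'l) fctr \<Rightarrow> ('o, 'm, 'p, 'n) fctr \<Rightarrow> ('o, 'm, 'r, 'l) fctr" where
  "fctr_comp C G F =
     \<lparr>onO = compose (Obj C) (onO G) (onO F), onA = compose (Arr C) (onA G) (onA F)\<rparr>"

definition op_cat :: "('o, 'm) cat \<Rightarrow> ('o, 'm) cat" where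
  "op_cat C = \<lparr>Obj = Obj C, Arr = Arr C, src = tgt C, tgt = src C, idn = idn C,
               cmp = (\<lambda>g f. cmp C f g)\<rparr>"

definition times_cat :: "('o, 'm) cat \<Rightarrow> ('p, 'n) cat \<Rightarrow> ('o \<times> 'p, 'm \<times> 'n) cat" where
  "times_cat C D = \<lparr>Obj = Obj C \<times> Obj D, Arr = Arr C \<times> Arr D,
     src = map_prod (src C) (src D), tgt = map_prod (tgt C) (tgt D),
     idn = map_prod (idn C) (idn D),
     cmp = (\<lambda>(g, g') (f, f'). (cmp C g f, cmp D g' f'))\<rparr>"

definition prod_cat :: "'i set \<Rightarrow> ('i \<Rightarrow> ('o, 'm) cat) \<Rightarrow> ('i \<Rightarrow> 'o, 'i \<Rightarrow> 'm) cat" where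
  "prod_cat I C = \<lparr>Obj = (\<Pi>\<^sub>E i\<in>I. Obj (C i)), Arr = (\<Pi>\<^sub>E i\<in>I. Arr (C i)),
     src = (\<lambda>f. \<lambda>i\<in>I. src (C i) (f i)), tgt = (\<lambda>f. \<lambda>i\<in>I. tgt (C i) (f i)),
     idn = (\<lambda>c. \<lambda>i\<in>I. idn (C i) (c i)),
     cmp = (\<lambda>g f. \<lambda>i\<in>I. cmp (C i) (g i) (f i))\<rparr>"

definition proj_fctr ::
  "'i set \<Rightarrow> ('i \<Rightarrow> ('o, 'm) cat) \<Rightarrow> 'i \<Rightarrow> ('i \<Rightarrow> 'o, 'i \<Rightarrow> 'm, 'o, 'm) fctr" where
  "proj_fctr I C i =
     \<lparr>onO = (\<lambda>c\<in>Obj (prod_cat I C). c i), onA = (\<lambda>f\<in>Arr (prod_cat I C). f i)\<rparr>"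

text \<open>The category underlying the free monoidal category. A list of arrows carries its own
  source and target lists, which therefore automatically have equal length.\<close>

definition free_mon :: "('o, 'm) cat \<Rightarrow> ('o list, 'm list) cat" where
  "free_mon B = \<lparr>Obj = lists (Obj B), Arr = lists (Arr B),
     src = map (src B), tgt = map (tgt B), idn = map (idn B), cmp = map2 (cmp B)\<rparr>"

definition free_mon_fctr ::
  "('o, 'm) cat \<Rightarrow> ('o, 'm, 'p, 'n) fctr \<Rightarrow> ('o list, 'm list, 'p list, 'n list) fctr" where
  "free_mon_fctr B G =
     \<lparr>onO = restrict (map (onO G)) (Obj (free_mon B)),
      onA = restrict (map (onA G)) (Arr (free_mon B))\<rparr>"


section \<open>Set-valued functors\<close>

text \<open>Sets with elements in the type \<open>'x\<close>. An arrow is a triple of source, graph, target.\<close>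

type_synonym 'x set_arr = "'x set \<times> ('x \<Rightarrow> 'x) \<times> 'x set"

definition set_cat :: "('x set, 'x set_arr) cat" where
  "set_cat = \<lparr>Obj = UNIV, Arr = {(X, f, Y). f \<in> X \<rightarrow>\<^sub>E Y},
     src = (\<lambda>(X, f, Y). X), tgt = (\<lambda>(X, f, Y). Y), idn = (\<lambda>X. (X, \<lambda>x\<in>X. x, X)),
     cmp = (\<lambda>(Y, g, Z) (X, f, Y'). (X, compose X g f, Z))\<rparr>"

definition act :: "'x set_arr \<Rightarrow> 'x \<Rightarrow> 'x" where
  "act u = fst (snd u)"

text \<open>Natural transformations between set-valued functors whose values may live in different
  types; hence naturality is spelled out on elements.\<close>

definition set_nat_trans ::
  "('o, 'm) cat \<Rightarrow> ('o, 'm, 'x set, 'x set_arr) fctr \<Rightarrow> ('o, 'm, 'y set, 'y set_arr) fctr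
     \<Rightarrow> ('o \<Rightarrow> 'x \<Rightarrow> 'y) \<Rightarrow> bool" where
  "set_nat_trans C S T \<alpha> \<longleftrightarrow>
     \<alpha> \<in> (\<Pi>\<^sub>E c\<in>Obj C. onO S c \<rightarrow>\<^sub>E onO T c) \<and>
     (\<forall>f\<in>Arr C. \<forall>x\<in>onO S (src C f).
        \<alpha> (tgt C f) (act (onA S f) x) = act (onA T f) (\<alpha> (src C f) x))"


section \<open>2-transducers and their cells\<close>

text \<open>The category \<open>A \<times> Q\<^sup>o\<^sup>p \<times> Q \<times> (B\<^sup>*)\<^sup>o\<^sup>p\<close>.\<close>

definition tdx_dom ::
  "('ao, 'am) cat \<Rightarrow> ('qo, 'qm) cat \<Rightarrow> ('bo, 'bm) cat
     \<Rightarrow> ('ao \<times> 'qo \<times> 'qo \<times> 'bo list, 'am \<times> 'qm \<times> 'qm \<times> 'bm list) cat" where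
  "tdx_dom A Q B =
     times_cat A (times_cat (op_cat Q) (times_cat Q (op_cat (free_mon B))))"

record ('ao, 'am, 'bo, 'bm, 'qo, 'qm, 'x) tdx =
  states :: "('qo, 'qm) cat"
  val :: "('ao \<times> 'qo \<times> 'qo \<times> 'bo list, 'am \<times> 'qm \<times> 'qm \<times> 'bm list,
           'x set, 'x set_arr) fctr"

definition transducer ::
  "('ao, 'am) cat \<Rightarrow> ('bo, 'bm) cat \<Rightarrow> ('ao, 'am, 'bo, 'bm, 'qo, 'qm, 'x) tdx \<Rightarrow> bool" where
  "transducer A B T \<longleftrightarrow> category A \<and> category B \<and> category (states T) \<and>
     cat_functor (tdx_dom A (states T) B) set_cat (val T)"

text \<open>The functor \<open>F \<times> U\<^sup>o\<^sup>p \<times> U \<times> (G\<^sup>*)\<^sup>o\<^sup>p\<close> on \<open>tdx_dom A Q B\<close>.\<close>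

definition tdx_dom_fctr ::
  "('ao, 'am) cat \<Rightarrow> ('qo, 'qm) cat \<Rightarrow> ('bo, 'bm) cat \<Rightarrow>
   ('ao, 'am, 'co, 'cm) fctr \<Rightarrow> ('qo, 'qm, 'po, 'pm) fctr \<Rightarrow> ('bo, 'bm, 'do, 'dm) fctr \<Rightarrow>
   ('ao \<times> 'qo \<times> 'qo \<times> 'bo list, 'am \<times> 'qm \<times> 'qm \<times> 'bm list,
    'co \<times> 'po \<times> 'po \<times> 'do list, 'cm \<times> 'pm \<times> 'pm \<times> 'dm list) fctr" where
  "tdx_dom_fctr A Q B F U G =
     \<lparr>onO = (\<lambda>(a, q, q', bs)\<in>Obj (tdx_dom A Q B).
               (onO F a, onO U q, onO U q', onO (free_mon_fctr B G) bs)),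
      onA = (\<lambda>(f, u, u', ks)\<in>Arr (tdx_dom A Q B).
               (onA F f, onA U u, onA U u', onA (free_mon_fctr B G) ks))\<rparr>"

text \<open>A cell records its tight boundary \<open>F\<close>, \<open>G\<close> along with the pair \<open>(U, \<alpha>)\<close>, so equality of
  cells includes equality of boundaries.\<close>

record ('ao, 'am, 'bo, 'bm, 'qo, 'qm, 'x, 'co, 'cm, 'do, 'dm, 'po, 'pm, 'y) tdx_cell =
  tightL :: "('ao, 'am, 'co, 'cm) fctr"
  tightR :: "('bo, 'bm, 'do, 'dm) fctr"
  onStates :: "('qo, 'qm, 'po, 'pm) fctr"
  component :: "'ao \<times> 'qo \<times> 'qo \<times> 'bo list \<Rightarrow> 'x \<Rightarrow> 'y"

definition cell ::
  "('ao, 'am) cat \<Rightarrow> ('bo, 'bm) cat \<Rightarrow> ('ao, 'am, 'bo, 'bm, 'qo, 'qm, 'x) tdx \<Rightarrow>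
   ('co, 'cm) cat \<Rightarrow> ('do, 'dm) cat \<Rightarrow> ('co, 'cm, 'do, 'dm, 'po, 'pm, 'y) tdx \<Rightarrow>
   ('ao, 'am, 'bo, 'bm, 'qo, 'qm, 'x, 'co, 'cm, 'do, 'dm, 'po, 'pm, 'y) tdx_cell \<Rightarrow> bool" where
  "cell A B S A' B' T \<kappa> \<longleftrightarrow>
     cat_functor A A' (tightL \<kappa>) \<and> cat_functor B B' (tightR \<kappa>) \<and>
     cat_functor (states S) (states T) (onStates \<kappa>) \<and>
     set_nat_trans (tdx_dom A (states S) B) (val S)
       (fctr_comp (tdx_dom A (states S) B) (val T)
          (tdx_dom_fctr A (states S) B (tightL \<kappa>) (onStates \<kappa>) (tightR \<kappa>)))
       (component \<kappa>)"

text \<open>Vertical composite of \<open>\<kappa>\<close> out of \<open>S : A \<leadsto> B\<close> followed by \<open>\<mu>\<close>: the second natural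
  transformation is whiskered with the functor induced by \<open>\<kappa>\<close>.\<close>

definition cell_comp ::
  "('ao, 'am) cat \<Rightarrow> ('bo, 'bm) cat \<Rightarrow> ('ao, 'am, 'bo, 'bm, 'qo, 'qm, 'x) tdx \<Rightarrow>
   ('co, 'cm, 'do, 'dm, 'po, 'pm, 'y, 'eo, 'em, 'fo, 'fm, 'ro, 'rm, 'z) tdx_cell \<Rightarrow>
   ('ao, 'am, 'bo, 'bm, 'qo, 'qm, 'x, 'co, 'cm, 'do, 'dm, 'po, 'pm, 'y) tdx_cell \<Rightarrow>
   ('ao, 'am, 'bo, 'bm, 'qo, 'qm, 'x, 'eo, 'em, 'fo, 'fm, 'ro, 'rm, 'z) tdx_cell" where
  "cell_comp A B S \<mu> \<kappa> =
     \<lparr>tightL = fctr_comp A (tightL \<mu>) (tightL \<kappa>),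
      tightR = fctr_comp B (tightR \<mu>) (tightR \<kappa>),
      onStates = fctr_comp (states S) (onStates \<mu>) (onStates \<kappa>),
      component = (\<lambda>c\<in>Obj (tdx_dom A (states S) B).
        compose (onO (val S) c)
          (component \<mu>
             (onO (tdx_dom_fctr A (states S) B (tightL \<kappa>) (onStates \<kappa>) (tightR \<kappa>)) c))
          (component \<kappa> c))\<rparr>"


section \<open>The product of a family of 2-transducers\<close>

definition prod_tdx_obj ::
  "'i set \<Rightarrow> ('i \<Rightarrow> ('bo, 'bm) cat) \<Rightarrow> ('i \<Rightarrow> ('ao, 'am, 'bo, 'bm, 'qo, 'qm, 'x) tdx)
     \<Rightarrow> ('i \<Rightarrow> 'ao) \<times> ('i \<Rightarrow> 'qo) \<times> ('i \<Rightarrow> 'qo) \<times> ('i \<Rightarrow> 'bo) list \<Rightarrow> ('i \<Rightarrow> 'x) set" where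
  "prod_tdx_obj I B T = (\<lambda>(a, q, q', bs).
     \<Pi>\<^sub>E i\<in>I. onO (val (T i))
       (a i, q i, q' i, onO (free_mon_fctr (prod_cat I B) (proj_fctr I B i)) bs))"

definition prod_tdx ::
  "'i set \<Rightarrow> ('i \<Rightarrow> ('ao, 'am) cat) \<Rightarrow> ('i \<Rightarrow> ('bo, 'bm) cat)
     \<Rightarrow> ('i \<Rightarrow> ('ao, 'am, 'bo, 'bm, 'qo, 'qm, 'x) tdx)
     \<Rightarrow> ('i \<Rightarrow> 'ao, 'i \<Rightarrow> 'am, 'i \<Rightarrow> 'bo, 'i \<Rightarrow> 'bm, 'i \<Rightarrow> 'qo, 'i \<Rightarrow> 'qm, 'i \<Rightarrow> 'x) tdx" where
  "prod_tdx I A B T = (let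
     Q = prod_cat I (\<lambda>i. states (T i));
     D = tdx_dom (prod_cat I A) Q (prod_cat I B)
   in \<lparr>states = Q,
       val = \<lparr>onO = restrict (prod_tdx_obj I B T) (Obj D),
              onA = (\<lambda>(f, u, u', ks)\<in>Arr D.
                let X = prod_tdx_obj I B T (src D (f, u, u', ks));
                    Y = prod_tdx_obj I B T (tgt D (f, u, u', ks))
                in (X,
                    \<lambda>x\<in>X. \<lambda>i\<in>I. act (onA (val (T i)) (f i, u i, u' i,
                      onA (free_mon_fctr (prod_cat I B) (proj_fctr I B i)) ks)) (x i),
                    Y))\<rparr>\<rparr>)"

text \<open>Restricting to \<open>Obj\<close> and to the values of the product keeps components extensional.\<close>

definition proj_cell ::
  "'i set \<Rightarrow> ('i \<Rightarrow> ('ao, 'am) cat) \<Rightarrow> ('i \<Rightarrow> ('bo, 'bm) cat)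
     \<Rightarrow> ('i \<Rightarrow> ('ao, 'am, 'bo, 'bm, 'qo, 'qm, 'x) tdx) \<Rightarrow> 'i
     \<Rightarrow> ('i \<Rightarrow> 'ao, 'i \<Rightarrow> 'am, 'i \<Rightarrow> 'bo, 'i \<Rightarrow> 'bm, 'i \<Rightarrow> 'qo, 'i \<Rightarrow> 'qm, 'i \<Rightarrow> 'x,
         'ao, 'am, 'bo, 'bm, 'qo, 'qm, 'x) tdx_cell" where
  "proj_cell I A B T i =
     \<lparr>tightL = proj_fctr I A i,
      tightR = proj_fctr I B i,
      onStates = proj_fctr I (\<lambda>j. states (T j)) i,
      component =
        (\<lambda>c\<in>Obj (tdx_dom (prod_cat I A) (states (prod_tdx I A B T)) (prod_cat I B)).
           \<lambda>x\<in>onO (val (prod_tdx I A B T)) c. x i)\<rparr>"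

end

theory Submission
  imports Defs
begin

text \<open>
  The value functor of the product transducer is the pointwise product of the set-valued functors
  \<open>t\<^sub>i \<circ> (\<pi>\<^sub>i \<times> \<pi>\<^sub>i\<^sup>o\<^sup>p \<times> \<pi>\<^sub>i \<times> (\<pi>\<^sub>i\<^sup>*)\<^sup>o\<^sup>p)\<close>. Pointwise products are stable under
  precomposition, so a cell into the product whose tight boundary and state functor are the tuples
  of the given ones is a natural transformation into the pointwise product of the functors
  \<open>t\<^sub>i \<circ> (F\<^sub>i \<times> U\<^sub>i\<^sup>o\<^sup>p \<times> U\<^sub>i \<times> (G\<^sub>i\<^sup>*)\<^sup>o\<^sup>p)\<close>, that is, a family of natural transformations into
  its factors.
\<close>

section \<open>Products of categories and tuples of functors\<close>

lemma category_op_cat: "category C \<Longrightarrow> category (op_cat C)"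
  unfolding category_def op_cat_def by simp

lemma category_times_cat:
  assumes "category C" "category D"
  shows "category (times_cat C D)"
  using assms unfolding category_def times_cat_def by auto

text \<open>Every law holds coordinate by coordinate. The care goes into extensionality: the
  operations of \<open>prod_cat\<close> return families restricted to \<open>I\<close>, so an
  equation of families reduces to its coordinates in \<open>I\<close>.\<close>

lemma category_prod_cat:
  assumes "\<And>i. i \<in> I \<Longrightarrow> category (C i)"
  shows "category (prod_cat I C)"
proof -
  note [simp] = category.src_in[OF assms] category.tgt_in[OF assms] category.idn_in[OF assms]
    category.src_idn[OF assms] category.tgt_idn[OF assms] category.cmp_in[OF assms]
    category.src_cmp[OF assms] category.tgt_cmp[OF assms]
    category.cmp_idn_right[OF assms] category.cmp_idn_left[OF assms]
  have mem: "f i \<in> Arr (C i)" if "f \<in> Arr (prod_cat I C)" "i \<in> I" for f i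
    using that by (auto simp: prod_cat_def)
  have obj: "c i \<in> Obj (C i)" if "c \<in> Obj (prod_cat I C)" "i \<in> I" for c i
    using that by (auto simp: prod_cat_def)
  have eq: "src (C i) (g i) = tgt (C i) (f i)"
    if "src (prod_cat I C) g = tgt (prod_cat I C) f" "i \<in> I" for f g i
    using fun_cong[OF that(1), of i] that(2) by (simp add: prod_cat_def)
  \<comment> \<open>The unit and identity laws produce a restricted family; it is the original one
    because members of \<open>PiE\<close> are already \<open>undefined\<close> off
    \<open>I\<close>.\<close>
  have extO: "(\<lambda>i\<in>I. c i) = c" if "c \<in> Obj (prod_cat I C)" for c
    using that by (simp add: prod_cat_def PiE_restrict)
  have extA: "(\<lambda>i\<in>I. f i) = f" if "f \<in> Arr (prod_cat I C)" for f
    using that by (simp add: prod_cat_def PiE_restrict)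
  show ?thesis
  proof
    fix f assume f: "f \<in> Arr (prod_cat I C)"
    have "(\<lambda>i\<in>I. cmp (C i) (f i) (idn (C i) (src (C i) (f i)))) = (\<lambda>i\<in>I. f i)"
      "(\<lambda>i\<in>I. cmp (C i) (idn (C i) (tgt (C i) (f i))) (f i)) = (\<lambda>i\<in>I. f i)"
      by (auto intro!: restrict_ext simp: mem[OF f])
    then show "cmp (prod_cat I C) f (idn (prod_cat I C) (src (prod_cat I C) f)) = f"
      "cmp (prod_cat I C) (idn (prod_cat I C) (tgt (prod_cat I C) f)) f = f"
      using extA[OF f] by (auto simp: prod_cat_def cong: restrict_cong)
  next
    fix c assume c: "c \<in> Obj (prod_cat I C)"
    have "(\<lambda>i\<in>I. src (C i) (idn (C i) (c i))) = (\<lambda>i\<in>I. c i)"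
      "(\<lambda>i\<in>I. tgt (C i) (idn (C i) (c i))) = (\<lambda>i\<in>I. c i)"
      by (auto intro!: restrict_ext simp: obj[OF c])
    then show "src (prod_cat I C) (idn (prod_cat I C) c) = c"
      "tgt (prod_cat I C) (idn (prod_cat I C) c) = c"
      using extO[OF c] by (auto simp: prod_cat_def cong: restrict_cong)
  next
    fix f g h
    assume "f \<in> Arr (prod_cat I C)" "g \<in> Arr (prod_cat I C)" "h \<in> Arr (prod_cat I C)"
      "src (prod_cat I C) g = tgt (prod_cat I C) f" "src (prod_cat I C) h = tgt (prod_cat I C) g"
    note fgh = this
    show "cmp (prod_cat I C) h (cmp (prod_cat I C) g f) =
        cmp (prod_cat I C) (cmp (prod_cat I C) h g) f"
      using mem[OF fgh(1)] mem[OF fgh(2)] mem[OF fgh(3)] eq[OF fgh(4)] eq[OF fgh(5)]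
      by (auto simp: prod_cat_def category.cmp_assoc[OF assms] intro!: restrict_ext)
  next
    fix f g
    assume "f \<in> Arr (prod_cat I C)" "g \<in> Arr (prod_cat I C)"
      "src (prod_cat I C) g = tgt (prod_cat I C) f"
    note fg = mem[OF this(1)] mem[OF this(2)] eq[OF this(3)]
    show "cmp (prod_cat I C) g f \<in> Arr (prod_cat I C)"
      "src (prod_cat I C) (cmp (prod_cat I C) g f) = src (prod_cat I C) f"
      "tgt (prod_cat I C) (cmp (prod_cat I C) g f) = tgt (prod_cat I C) g"
      using fg by (auto simp: prod_cat_def intro!: restrict_ext)
  qed (auto simp: prod_cat_def dest: PiE_mem)
qed

text \<open>Composability equates whole lists of objects, hence forces equal lengths. So
  \<open>map2\<close> truncates nothing, and each law can be checked entry by entry.\<close>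

lemma category_free_mon:
  assumes "category C"
  shows "category (free_mon C)"
proof -
  interpret category C by fact
  note [simp] = src_in tgt_in idn_in src_idn tgt_idn cmp_in src_cmp tgt_cmp
    cmp_idn_right cmp_idn_left
  have len: "length fs = length gs" if "map (src C) gs = map (tgt C) fs" for fs gs
    using that by (metis length_map)
  have mem: "fs ! k \<in> Arr C" if "fs \<in> lists (Arr C)" "k < length fs" for fs k
    using that by (auto simp: in_lists_conv_set)
  have nth: "src C (gs ! k) = tgt C (fs ! k)"
    if "map (src C) gs = map (tgt C) fs" "k < length fs" for fs gs k
    using that by (metis len nth_map)
  have zip: "g \<in> Arr C \<and> f \<in> Arr C \<and> src C g = tgt C f"
    if "map (src C) gs = map (tgt C) fs" "gs \<in> lists (Arr C)" "fs \<in> lists (Arr C)"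
      "(g, f) \<in> set (zip gs fs)" for fs gs g f
    using that by (auto simp: in_set_zip nth mem len)
  show ?thesis
  proof
    fix f g
    assume "f \<in> Arr (free_mon C)" "g \<in> Arr (free_mon C)"
      "src (free_mon C) g = tgt (free_mon C) f"
    note fg = this[unfolded free_mon_def, simplified]
    show "cmp (free_mon C) g f \<in> Arr (free_mon C)"
      using zip[of g f] fg by (force simp: free_mon_def in_lists_conv_set)
    show "src (free_mon C) (cmp (free_mon C) g f) = src (free_mon C) f"
      "tgt (free_mon C) (cmp (free_mon C) g f) = tgt (free_mon C) g"
      using fg len[of g f] by (auto simp: free_mon_def mem nth intro!: nth_equalityI)
  next
    fix f g h
    assume "f \<in> Arr (free_mon C)" "g \<in> Arr (free_mon C)" "h \<in> Arr (free_mon C)"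
      "src (free_mon C) g = tgt (free_mon C) f" "src (free_mon C) h = tgt (free_mon C) g"
    note fgh = this[unfolded free_mon_def, simplified]
    show "cmp (free_mon C) h (cmp (free_mon C) g f) = cmp (free_mon C) (cmp (free_mon C) h g) f"
      using fgh len[of g f] len[of h g]
      by (auto simp: free_mon_def mem nth cmp_assoc intro!: nth_equalityI)
  qed (auto simp: free_mon_def in_lists_conv_set mem intro!: nth_equalityI)
qed

section \<open>Extensional functors and their composites\<close>

lemma cat_functor_onO: "cat_functor C D F \<Longrightarrow> c \<in> Obj C \<Longrightarrow> onO F c \<in> Obj D"
  using cat_functor.onO_in by (blast intro: PiE_mem)

lemma cat_functor_onA: "cat_functor C D F \<Longrightarrow> f \<in> Arr C \<Longrightarrow> onA F f \<in> Arr D"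
  using cat_functor.onA_in by (blast intro: PiE_mem)

lemma cat_functor_eqI:
  assumes "cat_functor C D F" "cat_functor C D G"
    and "\<And>c. c \<in> Obj C \<Longrightarrow> onO F c = onO G c"
    and "\<And>f. f \<in> Arr C \<Longrightarrow> onA F f = onA G f"
  shows "F = G"
proof (rule fctr.equality)
  show "onO F = onO G"
    using assms cat_functor.onO_in by (metis PiE_ext)
  show "onA F = onA G"
    using assms cat_functor.onA_in by (metis PiE_ext)
qed simp

lemma cat_functor_fctr_comp:
  assumes "category C" "cat_functor C D F" "cat_functor D E G"
  shows "cat_functor C E (fctr_comp C G F)"
proof -
  interpret C: category C by fact
  interpret F: cat_functor C D F by fact
  interpret G: cat_functor D E G by fact
  note mem = cat_functor_onO[OF assms(2)] cat_functor_onA[OF assms(2)]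
    cat_functor_onO[OF assms(3)] cat_functor_onA[OF assms(3)]
  show ?thesis
    by unfold_locales
      (simp_all add: fctr_comp_def compose_def mem C.src_in C.tgt_in C.idn_in C.cmp_in
        F.onA_src F.onA_tgt F.onA_idn F.onA_cmp G.onA_src G.onA_tgt G.onA_idn G.onA_cmp)
qed

text \<open>Since \<open>F\<close> takes values in \<open>D\<close>, the restriction to
  \<open>D\<close> inside \<open>fctr_comp D H G\<close> is invisible after composing.\<close>

lemma fctr_comp_assoc:
  assumes "cat_functor C D F"
  shows "fctr_comp C (fctr_comp D H G) F = fctr_comp C H (fctr_comp C G F)"
  by (simp add: fctr_comp_def compose_def cat_functor_onO[OF assms] cat_functor_onA[OF assms]
      cong: restrict_cong)

section \<open>The universal property of a product of categories\<close>

lemma cat_functor_proj_fctr: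
  assumes "\<And>i. i \<in> I \<Longrightarrow> category (C i)" and "i \<in> I"
  shows "cat_functor (prod_cat I C) (C i) (proj_fctr I C i)"
proof -
  interpret P: category "prod_cat I C"
    using assms(1) by (rule category_prod_cat)
  show ?thesis
    using \<open>i \<in> I\<close>
    by unfold_locales
      (simp_all add: proj_fctr_def P.src_in P.tgt_in P.idn_in P.cmp_in,
       auto simp: prod_cat_def)
qed

definition tuple_fctr ::
  "('o, 'm) cat \<Rightarrow> 'i set \<Rightarrow> ('i \<Rightarrow> ('o, 'm, 'p, 'n) fctr) \<Rightarrow> ('o, 'm, 'i \<Rightarrow> 'p, 'i \<Rightarrow> 'n) fctr" where
  "tuple_fctr C I F =
     \<lparr>onO = (\<lambda>c\<in>Obj C. \<lambda>i\<in>I. onO (F i) c), onA = (\<lambda>f\<in>Arr C. \<lambda>i\<in>I. onA (F i) f)\<rparr>"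

lemma cat_functor_tuple_fctr:
  assumes "category C" and F: "\<And>i. i \<in> I \<Longrightarrow> cat_functor C (D i) (F i)"
  shows "cat_functor C (prod_cat I D) (tuple_fctr C I F)"
proof -
  interpret C: category C by fact
  show ?thesis
    by unfold_locales
      (auto simp: tuple_fctr_def prod_cat_def C.src_in C.tgt_in C.idn_in C.cmp_in
        cat_functor_onO[OF F] cat_functor_onA[OF F] cat_functor.onA_src[OF F]
        cat_functor.onA_tgt[OF F] cat_functor.onA_idn[OF F] cat_functor.onA_cmp[OF F])
qed

lemma proj_fctr_comp_tuple_fctr:
  assumes "category C" and D: "\<And>i. i \<in> I \<Longrightarrow> category (D i)"
    and F: "\<And>i. i \<in> I \<Longrightarrow> cat_functor C (D i) (F i)" and "i \<in> I"
  shows "fctr_comp C (proj_fctr I D i) (tuple_fctr C I F) = F i"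
proof (rule cat_functor_eqI)
  have T: "cat_functor C (prod_cat I D) (tuple_fctr C I F)"
    using assms(1) F by (rule cat_functor_tuple_fctr)
  show "cat_functor C (D i) (fctr_comp C (proj_fctr I D i) (tuple_fctr C I F))"
    by (rule cat_functor_fctr_comp[OF assms(1) T cat_functor_proj_fctr]) (fact D, fact)
  show "cat_functor C (D i) (F i)"
    using \<open>i \<in> I\<close> by (rule F)
qed (use \<open>i \<in> I\<close> in \<open>auto simp: fctr_comp_def compose_def proj_fctr_def tuple_fctr_def
      prod_cat_def cat_functor_onO[OF F] cat_functor_onA[OF F]\<close>)

text \<open>Composing with the projection at \<open>i\<close> reads off the coordinate at
  \<open>i\<close> of each value of \<open>G\<close>, and an extensional family is determined by its
  coordinates.\<close>

lemma tuple_fctr_unique: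
  assumes "category C" and G: "cat_functor C (prod_cat I D) G"
    and F: "\<And>i. i \<in> I \<Longrightarrow> cat_functor C (D i) (F i)"
    and comp: "\<And>i. i \<in> I \<Longrightarrow> fctr_comp C (proj_fctr I D i) G = F i"
  shows "G = tuple_fctr C I F"
proof (rule cat_functor_eqI)
  show "cat_functor C (prod_cat I D) G" by fact
  show "cat_functor C (prod_cat I D) (tuple_fctr C I F)"
    using assms(1) F by (rule cat_functor_tuple_fctr)
next
  fix c assume c: "c \<in> Obj C"
  show "onO G c = onO (tuple_fctr C I F) c"
  proof (rule PiE_ext)
    show "onO G c \<in> (\<Pi>\<^sub>E i\<in>I. Obj (D i))"
      using cat_functor_onO[OF G c] by (simp add: prod_cat_def)
    show "onO (tuple_fctr C I F) c \<in> (\<Pi>\<^sub>E i\<in>I. Obj (D i))"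
      using c by (auto simp: tuple_fctr_def cat_functor_onO[OF F])
  qed (use c cat_functor_onO[OF G c] in
      \<open>simp add: comp[symmetric] tuple_fctr_def fctr_comp_def compose_def proj_fctr_def\<close>)
next
  fix f assume f: "f \<in> Arr C"
  show "onA G f = onA (tuple_fctr C I F) f"
  proof (rule PiE_ext)
    show "onA G f \<in> (\<Pi>\<^sub>E i\<in>I. Arr (D i))"
      using cat_functor_onA[OF G f] by (simp add: prod_cat_def)
    show "onA (tuple_fctr C I F) f \<in> (\<Pi>\<^sub>E i\<in>I. Arr (D i))"
      using f by (auto simp: tuple_fctr_def cat_functor_onA[OF F])
  qed (use f cat_functor_onA[OF G f] in
      \<open>simp add: comp[symmetric] tuple_fctr_def fctr_comp_def compose_def proj_fctr_def\<close>)
qed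

section \<open>Functoriality of the free monoidal category\<close>

lemma cat_functor_free_mon_fctr:
  assumes "category C" "cat_functor C D F"
  shows "cat_functor (free_mon C) (free_mon D) (free_mon_fctr C F)"
proof -
  interpret M: category "free_mon C"
    using assms(1) by (rule category_free_mon)
  interpret F: cat_functor C D F by fact
  note mem = cat_functor_onO[OF assms(2)] cat_functor_onA[OF assms(2)]
  show ?thesis
  proof
    fix f g
    assume fg: "f \<in> Arr (free_mon C)" "g \<in> Arr (free_mon C)"
      "src (free_mon C) g = tgt (free_mon C) f"
    from fg(3) have eq: "map (src C) g = map (tgt C) f"
      by (simp add: free_mon_def)
    \<comment> \<open>Equal lengths permit simultaneous induction on both lists, which consumes the
      composability condition one pair of arrows at a time.\<close>
    then have "length g = length f"
      by (metis length_map)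
    then have "map (onA F) (map2 (cmp C) g f) = map2 (cmp D) (map (onA F) g) (map (onA F) f)"
      using fg(1,2)[unfolded free_mon_def, simplified] eq
      by (induction rule: list_induct2) (auto simp: F.onA_cmp)
    \<comment> \<open>\<open>free_mon_fctr\<close> is restricted to lists of arrows, so the
      composite must be known to be one before the map on it can be unfolded.\<close>
    moreover have "cmp (free_mon C) g f \<in> Arr (free_mon C)"
      using fg by (rule M.cmp_in)
    ultimately show "onA (free_mon_fctr C F) (cmp (free_mon C) g f) =
        cmp (free_mon D) (onA (free_mon_fctr C F) g) (onA (free_mon_fctr C F) f)"
      using fg by (simp add: free_mon_fctr_def) (simp add: free_mon_def)
  qed (simp_all add: free_mon_fctr_def M.src_in M.tgt_in M.idn_in,
      auto simp: free_mon_def in_lists_conv_set F.onA_src F.onA_tgt F.onA_idn mem)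
qed

lemma free_mon_fctr_comp:
  assumes "cat_functor B C F"
  shows "free_mon_fctr B (fctr_comp B G F) =
    fctr_comp (free_mon B) (free_mon_fctr C G) (free_mon_fctr B F)"
  by (auto simp: free_mon_fctr_def fctr_comp_def free_mon_def in_lists_conv_set compose_def
      cat_functor_onO[OF assms] cat_functor_onA[OF assms] intro!: restrict_ext)

section \<open>The domain of a 2-transducer\<close>

text \<open>These rules open the products and opposites but keep \<open>free_mon B\<close> folded,
  so that the laws for lists apply to the last coordinate as a whole.\<close>

lemma tdx_dom_simps:
  "Obj (tdx_dom A Q B) = Obj A \<times> Obj Q \<times> Obj Q \<times> Obj (free_mon B)"
  "Arr (tdx_dom A Q B) = Arr A \<times> Arr Q \<times> Arr Q \<times> Arr (free_mon B)"
  "src (tdx_dom A Q B) (f, u, u', k) = (src A f, tgt Q u, src Q u', tgt (free_mon B) k)"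
  "tgt (tdx_dom A Q B) (f, u, u', k) = (tgt A f, src Q u, tgt Q u', src (free_mon B) k)"
  "idn (tdx_dom A Q B) (a, q, q', b) = (idn A a, idn Q q, idn Q q', idn (free_mon B) b)"
  "cmp (tdx_dom A Q B) (g, v, v', l) (f, u, u', k) =
    (cmp A g f, cmp Q u v, cmp Q v' u', cmp (free_mon B) k l)"
  by (simp_all add: tdx_dom_def times_cat_def op_cat_def)

lemma category_tdx_dom:
  assumes "category A" "category Q" "category B"
  shows "category (tdx_dom A Q B)"
  unfolding tdx_dom_def
  by (intro category_times_cat category_op_cat category_free_mon assms)

lemma cat_functor_tdx_dom_fctr:
  assumes "category A" "category Q" "category B"
    and F: "cat_functor A A' F" and U: "cat_functor Q Q' U" and G: "cat_functor B B' G"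
  shows "cat_functor (tdx_dom A Q B) (tdx_dom A' Q' B') (tdx_dom_fctr A Q B F U G)"
proof -
  interpret A: category A by fact
  interpret Q: category Q by fact
  interpret M: category "free_mon B"
    using assms(3) by (rule category_free_mon)
  interpret F: cat_functor A A' F by fact
  interpret U: cat_functor Q Q' U by fact
  have G': "cat_functor (free_mon B) (free_mon B') (free_mon_fctr B G)"
    using assms(3) G by (rule cat_functor_free_mon_fctr)
  interpret G: cat_functor "free_mon B" "free_mon B'" "free_mon_fctr B G" by fact
  note [simp] = cat_functor_onO[OF F] cat_functor_onO[OF U] cat_functor_onO[OF G']
    cat_functor_onA[OF F] cat_functor_onA[OF U] cat_functor_onA[OF G']
    A.src_in A.tgt_in A.idn_in A.cmp_in Q.src_in Q.tgt_in Q.idn_in Q.cmp_in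
    M.src_in M.tgt_in M.idn_in M.cmp_in
  show ?thesis
    by unfold_locales
      (auto simp: tdx_dom_fctr_def tdx_dom_simps F.onA_src F.onA_tgt F.onA_idn F.onA_cmp
        U.onA_src U.onA_tgt U.onA_idn U.onA_cmp G.onA_src G.onA_tgt G.onA_idn G.onA_cmp)
qed

text \<open>This makes whiskering compatible with vertical composition: the functor induced by a
  composite boundary is the composite of the induced functors. The list coordinate is handled by
  \<open>free_mon_fctr_comp\<close>.\<close>

lemma tdx_dom_fctr_comp:
  assumes "category B"
    and F: "cat_functor A A' F" and U: "cat_functor Q Q' U" and G: "cat_functor B B' G"
  shows "tdx_dom_fctr A Q B (fctr_comp A F' F) (fctr_comp Q U' U) (fctr_comp B G' G) =
    fctr_comp (tdx_dom A Q B) (tdx_dom_fctr A' Q' B' F' U' G') (tdx_dom_fctr A Q B F U G)"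
proof -
  have M: "cat_functor (free_mon B) (free_mon B') (free_mon_fctr B G)"
    using assms(1) G by (rule cat_functor_free_mon_fctr)
  show ?thesis
    unfolding tdx_dom_fctr_def free_mon_fctr_comp[OF G]
    by (auto simp: fctr_comp_def compose_def tdx_dom_simps
        cat_functor_onO[OF F] cat_functor_onO[OF U] cat_functor_onO[OF M]
        cat_functor_onA[OF F] cat_functor_onA[OF U] cat_functor_onA[OF M] intro!: restrict_ext)
qed

section \<open>Pointwise products of set-valued functors\<close>

text \<open>Functoriality fixes the source and target of the triple \<open>onA V f\<close>, so only
  its underlying function carries information. Set-valued functors can then be treated on elements
  through \<open>act\<close>.\<close>

lemma set_functor_onA:
  assumes "cat_functor C set_cat V" "f \<in> Arr C"
  shows "onA V f = (onO V (src C f), act (onA V f), onO V (tgt C f))"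
  using cat_functor.onA_src[OF assms] cat_functor.onA_tgt[OF assms]
  by (cases "onA V f") (simp add: set_cat_def act_def)

lemma set_functor_act:
  assumes "cat_functor C set_cat V" "f \<in> Arr C"
  shows "act (onA V f) \<in> onO V (src C f) \<rightarrow>\<^sub>E onO V (tgt C f)"
  using cat_functor_onA[OF assms] by (subst (asm) set_functor_onA[OF assms]) (simp add: set_cat_def)

lemma set_functor_act_mem:
  assumes "cat_functor C set_cat V" "f \<in> Arr C" "x \<in> onO V (src C f)"
  shows "act (onA V f) x \<in> onO V (tgt C f)"
  using set_functor_act[OF assms(1,2)] assms(3) by blast

lemma set_functor_act_idn:
  assumes "cat_functor C set_cat V" "c \<in> Obj C" "x \<in> onO V c"
  shows "act (onA V (idn C c)) x = x"
  using cat_functor.onA_idn[OF assms(1,2)] assms(3) by (simp add: set_cat_def act_def)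

lemma set_functor_act_cmp:
  assumes V: "cat_functor C set_cat V" and "f \<in> Arr C" "g \<in> Arr C" "src C g = tgt C f"
    and "x \<in> onO V (src C f)"
  shows "act (onA V (cmp C g f)) x = act (onA V g) (act (onA V f) x)"
proof -
  \<comment> \<open>Writing both arrows as explicit triples lets the pattern-matching composition of
    \<open>set_cat\<close> compute.\<close>
  have "onA V (cmp C g f) = cmp set_cat
      (onO V (src C g), act (onA V g), onO V (tgt C g))
      (onO V (src C f), act (onA V f), onO V (tgt C f))"
    using cat_functor.onA_cmp[OF assms(1-4)] assms(2,3) set_functor_onA[OF V] by metis
  then show ?thesis
    using assms(5) by (simp add: set_cat_def act_def compose_def)
qed

text \<open>The product in the category of set-valued functors on \<open>C\<close>. It is isolated
  from transducers so that its universal property can be proved over an arbitrary domain and used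
  over two different ones.\<close>

definition set_prod_fctr ::
  "('o, 'm) cat \<Rightarrow> 'i set \<Rightarrow> ('i \<Rightarrow> ('o, 'm, 'x set, 'x set_arr) fctr)
     \<Rightarrow> ('o, 'm, ('i \<Rightarrow> 'x) set, ('i \<Rightarrow> 'x) set_arr) fctr" where
  "set_prod_fctr C I V =
     \<lparr>onO = (\<lambda>c\<in>Obj C. \<Pi>\<^sub>E i\<in>I. onO (V i) c),
      onA = (\<lambda>f\<in>Arr C. (\<Pi>\<^sub>E i\<in>I. onO (V i) (src C f),
        \<lambda>x\<in>(\<Pi>\<^sub>E i\<in>I. onO (V i) (src C f)). \<lambda>i\<in>I. act (onA (V i) f) (x i),
        \<Pi>\<^sub>E i\<in>I. onO (V i) (tgt C f)))\<rparr>"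

lemma set_prod_fctr_onO [simp]:
  "c \<in> Obj C \<Longrightarrow> onO (set_prod_fctr C I V) c = (\<Pi>\<^sub>E i\<in>I. onO (V i) c)"
  by (simp add: set_prod_fctr_def)

lemma cat_functor_set_prod_fctr:
  assumes "category C" and V: "\<And>i. i \<in> I \<Longrightarrow> cat_functor C set_cat (V i)"
  shows "cat_functor C set_cat (set_prod_fctr C I V)"
proof -
  interpret C: category C by fact
  note [simp] = C.src_in C.tgt_in C.idn_in C.cmp_in C.src_idn C.tgt_idn C.src_cmp C.tgt_cmp
    set_functor_act_mem[OF V] set_functor_act_idn[OF V] set_functor_act_cmp[OF V]
  have mem: "act (onA (V i) f) (x i) \<in> onO (V i) (tgt C f)"
    if "i \<in> I" "f \<in> Arr C" "x \<in> (\<Pi>\<^sub>E i\<in>I. onO (V i) (src C f))" for i f x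
    using that by (auto intro: set_functor_act_mem[OF V])
  show ?thesis
  proof
    fix f g assume fg: "f \<in> Arr C" "g \<in> Arr C" "src C g = tgt C f"
    \<comment> \<open>The right-hand side is kept in the shape that composing the two actions on
      families produces, including the inner restricted family.\<close>
    have "(\<lambda>i\<in>I. act (onA (V i) (cmp C g f)) (x i)) =
        (\<lambda>i\<in>I. act (onA (V i) g) ((\<lambda>i\<in>I. act (onA (V i) f) (x i)) i))"
      if "x \<in> (\<Pi>\<^sub>E i\<in>I. onO (V i) (src C f))" for x
      using that fg by (auto intro!: restrict_ext set_functor_act_cmp[OF V])
    then show "onA (set_prod_fctr C I V) (cmp C g f) =
        cmp set_cat (onA (set_prod_fctr C I V) g) (onA (set_prod_fctr C I V) f)"
      using fg by (auto simp: set_prod_fctr_def set_cat_def compose_def mem intro!: restrict_ext)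
  next
    fix c assume c: "c \<in> Obj C"
    have "(\<lambda>i\<in>I. act (onA (V i) (idn C c)) (x i)) = x"
      if "x \<in> (\<Pi>\<^sub>E i\<in>I. onO (V i) c)" for x
    proof (rule PiE_ext[OF _ that])
      show "(\<lambda>i\<in>I. act (onA (V i) (idn C c)) (x i)) \<in> (\<Pi>\<^sub>E i\<in>I. onO (V i) c)"
        using c PiE_mem[OF that] by auto
      show "(\<lambda>i\<in>I. act (onA (V i) (idn C c)) (x i)) i = x i" if "i \<in> I" for i
        using that c PiE_mem[OF \<open>x \<in> _\<close> that] by simp
    qed
    then show "onA (set_prod_fctr C I V) (idn C c) = idn set_cat (onO (set_prod_fctr C I V) c)"
      using c by (auto simp: set_prod_fctr_def set_cat_def intro!: restrict_ext)
  qed (auto simp: set_prod_fctr_def set_cat_def mem)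
qed

text \<open>Products of set-valued functors are pointwise, so evaluating at \<open>onO F c\<close>
  before or after forming them gives the same set. On arrows the boundary sets match because
  \<open>F\<close> preserves sources and targets.\<close>

lemma set_prod_fctr_comp:
  assumes "category C" "cat_functor C D F"
  shows "fctr_comp C (set_prod_fctr D I V) F = set_prod_fctr C I (\<lambda>i. fctr_comp C (V i) F)"
  using assms(1)
  by (auto simp: fctr_comp_def set_prod_fctr_def compose_def cat_functor_onO[OF assms(2)]
      cat_functor_onA[OF assms(2)] cat_functor.onA_src[OF assms(2)]
      cat_functor.onA_tgt[OF assms(2)] category.src_in category.tgt_in
      intro!: restrict_ext)

text \<open>The product functor acts on each coordinate separately, so naturality of the tuple is
  naturality of each \<open>\<beta> i\<close>.\<close>

lemma set_nat_trans_tuple: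
  assumes "category C" and S: "cat_functor C set_cat S"
    and \<beta>: "\<And>i. i \<in> I \<Longrightarrow> set_nat_trans C S (V i) (\<beta> i)"
  shows "set_nat_trans C S (set_prod_fctr C I V)
    (\<lambda>c\<in>Obj C. \<lambda>x\<in>onO S c. \<lambda>i\<in>I. \<beta> i c x)"
proof -
  interpret C: category C by fact
  have mem: "\<beta> i c x \<in> onO (V i) c" if "i \<in> I" "c \<in> Obj C" "x \<in> onO S c" for i c x
    using \<beta>[OF that(1)] that(2,3) unfolding set_nat_trans_def by (blast dest: PiE_mem)
  have nat: "\<beta> i (tgt C f) (act (onA S f) x) = act (onA (V i) f) (\<beta> i (src C f) x)"
    if "i \<in> I" "f \<in> Arr C" "x \<in> onO S (src C f)" for i f x
    using \<beta>[OF that(1)] that(2,3) unfolding set_nat_trans_def by blast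
  show ?thesis
    unfolding set_nat_trans_def
    by (auto simp: C.src_in C.tgt_in set_functor_act_mem[OF S] mem nat)
      (auto simp: set_prod_fctr_def act_def mem nat[unfolded act_def] C.src_in
        intro!: restrict_ext)
qed

lemma set_nat_trans_proj:
  assumes "category C" and V: "\<And>i. i \<in> I \<Longrightarrow> cat_functor C set_cat (V i)" and "i \<in> I"
  shows "set_nat_trans C (set_prod_fctr C I V) (V i)
    (\<lambda>c\<in>Obj C. \<lambda>x\<in>onO (set_prod_fctr C I V) c. x i)"
proof -
  interpret C: category C by fact
  have S: "act (onA (set_prod_fctr C I V) f) x \<in> onO (set_prod_fctr C I V) (tgt C f)"
    if "f \<in> Arr C" "x \<in> onO (set_prod_fctr C I V) (src C f)" for f x
    using cat_functor_set_prod_fctr[OF assms(1) V] that by (rule set_functor_act_mem)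
  have "act (onA (set_prod_fctr C I V) f) x i = act (onA (V i) f) (x i)"
    if "f \<in> Arr C" "x \<in> onO (set_prod_fctr C I V) (src C f)" for f x
    using that \<open>i \<in> I\<close> by (simp add: set_prod_fctr_def act_def C.src_in)
  then show ?thesis
    using \<open>i \<in> I\<close> S unfolding set_nat_trans_def
    \<comment> \<open>Keeping the product values folded lets \<open>S\<close> remove the restriction
      on the evaluation map.\<close>
    by (auto simp: C.src_in C.tgt_in simp del: set_prod_fctr_onO) auto
qed

section \<open>The product transducer and its projections\<close>

lemma states_prod_tdx [simp]: "states (prod_tdx I A B T) = prod_cat I (\<lambda>i. states (T i))"
  by (simp add: prod_tdx_def Let_def)

text \<open>The functor induced by the boundary of \<open>proj_cell\<close>. Pulling
  \<open>val (T i)\<close> back along it places all factors on one common domain, where their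
  pointwise product can be formed.\<close>

definition proj_dom_fctr ::
  "'i set \<Rightarrow> ('i \<Rightarrow> ('ao, 'am) cat) \<Rightarrow> ('i \<Rightarrow> ('bo, 'bm) cat)
     \<Rightarrow> ('i \<Rightarrow> ('ao, 'am, 'bo, 'bm, 'qo, 'qm, 'x) tdx) \<Rightarrow> 'i
     \<Rightarrow> (('i \<Rightarrow> 'ao) \<times> ('i \<Rightarrow> 'qo) \<times> ('i \<Rightarrow> 'qo) \<times> ('i \<Rightarrow> 'bo) list,
         ('i \<Rightarrow> 'am) \<times> ('i \<Rightarrow> 'qm) \<times> ('i \<Rightarrow> 'qm) \<times> ('i \<Rightarrow> 'bm) list,
         'ao \<times> 'qo \<times> 'qo \<times> 'bo list, 'am \<times> 'qm \<times> 'qm \<times> 'bm list) fctr" where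
  "proj_dom_fctr I A B T i =
     tdx_dom_fctr (prod_cat I A) (prod_cat I (\<lambda>j. states (T j))) (prod_cat I B)
       (proj_fctr I A i) (proj_fctr I (\<lambda>j. states (T j)) i) (proj_fctr I B i)"

locale tdx_family =
  fixes I :: "'i set"
    and A :: "'i \<Rightarrow> ('ao, 'am) cat"
    and B :: "'i \<Rightarrow> ('bo, 'bm) cat"
    and T :: "'i \<Rightarrow> ('ao, 'am, 'bo, 'bm, 'qo, 'qm, 'x) tdx"
  assumes transducer: "\<And>i. i \<in> I \<Longrightarrow> transducer (A i) (B i) (T i)"
begin

abbreviation "D \<equiv> tdx_dom (prod_cat I A) (prod_cat I (\<lambda>i. states (T i))) (prod_cat I B)"

abbreviation "V i \<equiv> fctr_comp D (val (T i)) (proj_dom_fctr I A B T i)"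

lemma category_fam:
  assumes "i \<in> I"
  shows "category (A i)" "category (B i)" "category (states (T i))"
    and "cat_functor (tdx_dom (A i) (states (T i)) (B i)) set_cat (val (T i))"
  using transducer[OF assms] by (simp_all add: transducer_def)

lemma category_prods:
  shows "category (prod_cat I A)" "category (prod_cat I B)"
    "category (prod_cat I (\<lambda>i. states (T i)))"
  by (simp_all add: category_prod_cat category_fam)

lemma category_D: "category D"
  by (intro category_tdx_dom category_prods)

lemma cat_functor_projs:
  assumes "i \<in> I"
  shows "cat_functor (prod_cat I A) (A i) (proj_fctr I A i)"
    and "cat_functor (prod_cat I B) (B i) (proj_fctr I B i)"
    and "cat_functor (prod_cat I (\<lambda>i. states (T i))) (states (T i))
      (proj_fctr I (\<lambda>i. states (T i)) i)"
proof -
  show "cat_functor (prod_cat I A) (A i) (proj_fctr I A i)"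
    using category_fam(1) assms by (rule cat_functor_proj_fctr)
  show "cat_functor (prod_cat I B) (B i) (proj_fctr I B i)"
    using category_fam(2) assms by (rule cat_functor_proj_fctr)
  show "cat_functor (prod_cat I (\<lambda>i. states (T i))) (states (T i))
      (proj_fctr I (\<lambda>i. states (T i)) i)"
    using category_fam(3) assms
    by (rule cat_functor_proj_fctr[where C = "\<lambda>i. states (T i)"])
qed

lemma cat_functor_proj_dom_fctr:
  "i \<in> I \<Longrightarrow> cat_functor D (tdx_dom (A i) (states (T i)) (B i)) (proj_dom_fctr I A B T i)"
  unfolding proj_dom_fctr_def
  by (intro cat_functor_tdx_dom_fctr category_prods cat_functor_projs)

lemma cat_functor_V: "i \<in> I \<Longrightarrow> cat_functor D set_cat (V i)"
  using category_D cat_functor_proj_dom_fctr category_fam(4) by (rule cat_functor_fctr_comp)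

text \<open>On objects of \<open>D\<close> the restrictions in the projection functors disappear,
  and \<open>V i\<close> evaluates to the factor at \<open>i\<close> of the explicit
  formula.\<close>

lemma prod_tdx_obj_eq:
  assumes "c \<in> Obj D"
  shows "prod_tdx_obj I B T c = (\<Pi>\<^sub>E i\<in>I. onO (V i) c)"
  using assms
  by (auto simp: prod_tdx_obj_def fctr_comp_def compose_def proj_dom_fctr_def tdx_dom_fctr_def
      tdx_dom_simps proj_fctr_def intro!: PiE_cong)

text \<open>The bridge from the explicit formula to \<open>set_prod_fctr\<close>: functoriality of
  the product transducer and naturality of its projections become instances of the results on
  pointwise products.\<close>

lemma val_prod_tdx: "val (prod_tdx I A B T) = set_prod_fctr D I V"
proof (rule fctr.equality)
  show "onO (val (prod_tdx I A B T)) = onO (set_prod_fctr D I V)"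
    by (auto simp: prod_tdx_def Let_def set_prod_fctr_def prod_tdx_obj_eq intro!: restrict_ext)
  \<comment> \<open>The comparison of factors again, now for the functions induced by an arrow of
    \<open>D\<close>.\<close>
  have "act (onA (val (T i)) (f i, u i, u' i,
      onA (free_mon_fctr (prod_cat I B) (proj_fctr I B i)) k)) = act (onA (V i) (f, u, u', k))"
    if "(f, u, u', k) \<in> Arr D" for i f u u' k
    using that by (simp add: fctr_comp_def compose_def proj_dom_fctr_def tdx_dom_fctr_def
        tdx_dom_simps proj_fctr_def)
  then show "onA (val (prod_tdx I A B T)) = onA (set_prod_fctr D I V)"
    using category.src_in[OF category_D] category.tgt_in[OF category_D]
    by (auto simp: prod_tdx_def Let_def set_prod_fctr_def prod_tdx_obj_eq intro!: restrict_ext)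
qed simp

lemma transducer_prod_tdx: "transducer (prod_cat I A) (prod_cat I B) (prod_tdx I A B T)"
  using cat_functor_set_prod_fctr[OF category_D cat_functor_V]
  by (simp add: transducer_def category_prods val_prod_tdx)

lemma cell_proj_cell:
  assumes "i \<in> I"
  shows "cell (prod_cat I A) (prod_cat I B) (prod_tdx I A B T) (A i) (B i) (T i)
    (proj_cell I A B T i)"
  using cat_functor_projs[OF assms] set_nat_trans_proj[OF category_D cat_functor_V assms]
  by (simp add: cell_def proj_cell_def val_prod_tdx proj_dom_fctr_def)

end

section \<open>Tupling of cells\<close>

text \<open>The witness for the factorization. Its component is restricted in the object, the
  element and the index, so that all three layers are extensional.\<close>

definition tuple_cell ::
  "('xo, 'xm) cat \<Rightarrow> ('yo, 'ym) cat \<Rightarrow> ('xo, 'xm, 'yo, 'ym, 'po, 'pm, 'z) tdx \<Rightarrow> 'i set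
     \<Rightarrow> ('i \<Rightarrow> ('xo, 'xm, 'yo, 'ym, 'po, 'pm, 'z, 'ao, 'am, 'bo, 'bm, 'qo, 'qm, 'x) tdx_cell)
     \<Rightarrow> ('xo, 'xm, 'yo, 'ym, 'po, 'pm, 'z,
         'i \<Rightarrow> 'ao, 'i \<Rightarrow> 'am, 'i \<Rightarrow> 'bo, 'i \<Rightarrow> 'bm, 'i \<Rightarrow> 'qo, 'i \<Rightarrow> 'qm, 'i \<Rightarrow> 'x) tdx_cell" where
  "tuple_cell X Y S I H =
     \<lparr>tightL = tuple_fctr X I (\<lambda>i. tightL (H i)),
      tightR = tuple_fctr Y I (\<lambda>i. tightR (H i)),
      onStates = tuple_fctr (states S) I (\<lambda>i. onStates (H i)),
      component = (\<lambda>c\<in>Obj (tdx_dom X (states S) Y). \<lambda>x\<in>onO (val S) c. \<lambda>i\<in>I.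
        component (H i) c x)\<rparr>"

locale tdx_cone = tdx_family I A B T
  for I :: "'i set"
    and A :: "'i \<Rightarrow> ('ao, 'am) cat"
    and B :: "'i \<Rightarrow> ('bo, 'bm) cat"
    and T :: "'i \<Rightarrow> ('ao, 'am, 'bo, 'bm, 'qo, 'qm, 'x) tdx" +
  fixes X :: "('xo, 'xm) cat" and Y :: "('yo, 'ym) cat"
    and S :: "('xo, 'xm, 'yo, 'ym, 'po, 'pm, 'z) tdx"
    and H :: "'i \<Rightarrow> ('xo, 'xm, 'yo, 'ym, 'po, 'pm, 'z,
      'ao, 'am, 'bo, 'bm, 'qo, 'qm, 'x) tdx_cell"
  assumes transducer_S: "transducer X Y S"
    and cell_H: "\<And>i. i \<in> I \<Longrightarrow> cell X Y S (A i) (B i) (T i) (H i)"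
begin

abbreviation "E \<equiv> tdx_dom X (states S) Y"

abbreviation "dom_fctr K \<equiv> tdx_dom_fctr X (states S) Y (tightL K) (onStates K) (tightR K)"

lemma category_S: "category X" "category Y" "category (states S)" "cat_functor E set_cat (val S)"
  using transducer_S by (simp_all add: transducer_def)

lemma category_E: "category E"
  by (intro category_tdx_dom category_S)

lemma cat_functor_H:
  assumes "i \<in> I"
  shows "cat_functor X (A i) (tightL (H i))" "cat_functor Y (B i) (tightR (H i))"
    "cat_functor (states S) (states (T i)) (onStates (H i))"
    "set_nat_trans E (val S) (fctr_comp E (val (T i)) (dom_fctr (H i))) (component (H i))"
  using cell_H[OF assms] by (simp_all add: cell_def)

text \<open>The boundary of \<open>K\<close> is assumed to be the tuple of the given boundaries,
  with no condition on its component. The results then serve both \<open>tuple_cell\<close> and any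
  competing factorization.\<close>

context
  fixes K :: "('xo, 'xm, 'yo, 'ym, 'po, 'pm, 'z,
    'i \<Rightarrow> 'ao, 'i \<Rightarrow> 'am, 'i \<Rightarrow> 'bo, 'i \<Rightarrow> 'bm, 'i \<Rightarrow> 'qo, 'i \<Rightarrow> 'qm, 'i \<Rightarrow> 'x) tdx_cell"
  assumes K: "tightL K = tuple_fctr X I (\<lambda>i. tightL (H i))"
    "tightR K = tuple_fctr Y I (\<lambda>i. tightR (H i))"
    "onStates K = tuple_fctr (states S) I (\<lambda>i. onStates (H i))"
begin

lemma cat_functor_tuples:
  "cat_functor X (prod_cat I A) (tightL K)" "cat_functor Y (prod_cat I B) (tightR K)"
  "cat_functor (states S) (prod_cat I (\<lambda>i. states (T i))) (onStates K)"
  unfolding K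
  by (simp_all add: cat_functor_tuple_fctr category_S cat_functor_H)

lemma comp_tuples:
  assumes "i \<in> I"
  shows "fctr_comp X (proj_fctr I A i) (tightL K) = tightL (H i)"
    and "fctr_comp Y (proj_fctr I B i) (tightR K) = tightR (H i)"
    and "fctr_comp (states S) (proj_fctr I (\<lambda>i. states (T i)) i) (onStates K) = onStates (H i)"
  unfolding K
  using proj_fctr_comp_tuple_fctr[OF category_S(1) category_fam(1) cat_functor_H(1) assms]
    proj_fctr_comp_tuple_fctr[OF category_S(2) category_fam(2) cat_functor_H(2) assms]
    proj_fctr_comp_tuple_fctr[OF category_S(3) category_fam(3) cat_functor_H(3) assms]
  by simp_all

lemma cat_functor_dom_fctr: "cat_functor E D (dom_fctr K)"
  by (intro cat_functor_tdx_dom_fctr category_S cat_functor_tuples)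

text \<open>Forming the induced functor respects composition, and composing the boundary of
  \<open>K\<close> with the projections returns that of \<open>H i\<close>.\<close>

lemma proj_dom_fctr_comp:
  "i \<in> I \<Longrightarrow> fctr_comp E (proj_dom_fctr I A B T i) (dom_fctr K) = dom_fctr (H i)"
  unfolding proj_dom_fctr_def
  by (simp add: comp_tuples flip: tdx_dom_fctr_comp[OF category_S(2)
        cat_functor_tuples(1) cat_functor_tuples(3) cat_functor_tuples(2)])

text \<open>The product commutes with precomposition, and reassociating turns its factor at
  \<open>i\<close> into the target functor of the given cell \<open>H i\<close>. Cells with this
  boundary are thereby natural transformations into a product.\<close>

lemma val_prod_tdx_comp:
  "fctr_comp E (val (prod_tdx I A B T)) (dom_fctr K) =
    set_prod_fctr E I (\<lambda>i. fctr_comp E (val (T i)) (dom_fctr (H i)))"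
proof -
  have "fctr_comp E (V i) (dom_fctr K) = fctr_comp E (val (T i)) (dom_fctr (H i))"
    if "i \<in> I" for i
    by (simp add: fctr_comp_assoc[OF cat_functor_dom_fctr] proj_dom_fctr_comp[OF that])
  then show ?thesis
    unfolding val_prod_tdx set_prod_fctr_comp[OF category_E cat_functor_dom_fctr]
    \<comment> \<open>The factors are known to agree only for indices in \<open>I\<close>, hence the
      congruence rules.\<close>
    by (simp add: set_prod_fctr_def cong: PiE_cong restrict_cong)
qed

lemma cell_tuple_iff:
  "cell X Y S (prod_cat I A) (prod_cat I B) (prod_tdx I A B T) K \<longleftrightarrow>
    set_nat_trans E (val S)
      (set_prod_fctr E I (\<lambda>i. fctr_comp E (val (T i)) (dom_fctr (H i)))) (component K)"
  by (simp add: cell_def cat_functor_tuples val_prod_tdx_comp)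

lemma component_cell_comp_proj:
  assumes "cell X Y S (prod_cat I A) (prod_cat I B) (prod_tdx I A B T) K"
    and "c \<in> Obj E" "x \<in> onO (val S) c"
  shows "component (cell_comp X Y S (proj_cell I A B T i) K) c x = component K c x i"
proof -
  have "component K \<in> (\<Pi>\<^sub>E c\<in>Obj E. onO (val S) c \<rightarrow>\<^sub>E
      onO (fctr_comp E (val (prod_tdx I A B T)) (dom_fctr K)) c)"
    using assms(1) unfolding cell_def set_nat_trans_def by blast
  with assms(2,3) have "component K c x \<in>
      onO (fctr_comp E (val (prod_tdx I A B T)) (dom_fctr K)) c"
    by (blast dest: PiE_mem)
  \<comment> \<open>The projection component is \<open>undefined\<close> off the values of the
    product transducer; this membership makes it evaluation at \<open>i\<close>.\<close>
  then have "component K c x \<in> onO (val (prod_tdx I A B T)) (onO (dom_fctr K) c)"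
    using assms(2) by (simp add: fctr_comp_def compose_def)
  then show ?thesis
    using assms(2,3) cat_functor_onO[OF cat_functor_dom_fctr assms(2)]
    by (simp add: cell_comp_def proj_cell_def compose_def)
qed

end

section \<open>Existence and uniqueness of the factorization\<close>

lemma component_tuple_mem:
  assumes "i \<in> I"
  shows "component (H i) \<in> (\<Pi>\<^sub>E c\<in>Obj E. onO (val S) c \<rightarrow>\<^sub>E
    onO (fctr_comp E (val (T i)) (dom_fctr (H i))) c)"
  using cat_functor_H(4)[OF assms] unfolding set_nat_trans_def by blast

lemma cell_tuple_cell:
  "cell X Y S (prod_cat I A) (prod_cat I B) (prod_tdx I A B T) (tuple_cell X Y S I H)"
  using set_nat_trans_tuple[OF category_E category_S(4) cat_functor_H(4)]
  by (subst cell_tuple_iff) (simp_all add: tuple_cell_def)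

lemma proj_cell_comp_tuple_cell:
  assumes "i \<in> I"
  shows "cell_comp X Y S (proj_cell I A B T i) (tuple_cell X Y S I H) = H i"
proof (rule tdx_cell.equality)
  let ?K = "tuple_cell X Y S I H"
  have K: "tightL ?K = tuple_fctr X I (\<lambda>i. tightL (H i))"
    "tightR ?K = tuple_fctr Y I (\<lambda>i. tightR (H i))"
    "onStates ?K = tuple_fctr (states S) I (\<lambda>i. onStates (H i))"
    by (simp_all add: tuple_cell_def)
  show "tightL (cell_comp X Y S (proj_cell I A B T i) ?K) = tightL (H i)"
    "tightR (cell_comp X Y S (proj_cell I A B T i) ?K) = tightR (H i)"
    "onStates (cell_comp X Y S (proj_cell I A B T i) ?K) = onStates (H i)"
    using comp_tuples[OF K assms] by (simp_all add: cell_comp_def proj_cell_def)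
  show "component (cell_comp X Y S (proj_cell I A B T i) ?K) = component (H i)"
  proof
    fix c
    show "component (cell_comp X Y S (proj_cell I A B T i) ?K) c = component (H i) c"
    proof (cases "c \<in> Obj E")
      case True
      show ?thesis
      proof
        fix x
        show "component (cell_comp X Y S (proj_cell I A B T i) ?K) c x = component (H i) c x"
        proof (cases "x \<in> onO (val S) c")
          case x: True
          show ?thesis
            using component_cell_comp_proj[OF K cell_tuple_cell True x, of i] True x assms
            by (simp add: tuple_cell_def)
        next
          \<comment> \<open>Off the value set both sides are \<open>undefined\<close>: the composite
            through \<open>compose\<close>, the given component by its extensionality.\<close>
          case False
          then show ?thesis
            using True PiE_arb[OF PiE_mem[OF component_tuple_mem[OF assms] True] False]
            by (simp add: cell_comp_def compose_def)
        qed
      qed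
    next
      case False
      then show ?thesis
        using PiE_arb[OF component_tuple_mem[OF assms] False]
        by (simp add: cell_comp_def)
    qed
  qed
qed simp

lemma tuple_cell_unique:
  assumes K: "cell X Y S (prod_cat I A) (prod_cat I B) (prod_tdx I A B T) K"
    and comp: "\<And>i. i \<in> I \<Longrightarrow> cell_comp X Y S (proj_cell I A B T i) K = H i"
  shows "K = tuple_cell X Y S I H"
proof (rule tdx_cell.equality)
  let ?L = "tuple_cell X Y S I H"
  have KF: "cat_functor X (prod_cat I A) (tightL K)" "cat_functor Y (prod_cat I B) (tightR K)"
    "cat_functor (states S) (prod_cat I (\<lambda>i. states (T i))) (onStates K)"
    using K by (simp_all add: cell_def)
  have L: "tightL ?L = tuple_fctr X I (\<lambda>i. tightL (H i))"
    "tightR ?L = tuple_fctr Y I (\<lambda>i. tightR (H i))"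
    "onStates ?L = tuple_fctr (states S) I (\<lambda>i. onStates (H i))"
    by (simp_all add: tuple_cell_def)
  \<comment> \<open>The boundary fields of the equations \<open>comp\<close> say that the functors
    of \<open>K\<close> project to those of the \<open>H i\<close>, so uniqueness of tuples
    applies.\<close>
  have KH: "tightL K = tuple_fctr X I (\<lambda>i. tightL (H i))"
    "tightR K = tuple_fctr Y I (\<lambda>i. tightR (H i))"
    "onStates K = tuple_fctr (states S) I (\<lambda>i. onStates (H i))"
    using tuple_fctr_unique[OF category_S(1) KF(1) cat_functor_H(1)]
      tuple_fctr_unique[OF category_S(2) KF(2) cat_functor_H(2)]
      tuple_fctr_unique[OF category_S(3) KF(3) cat_functor_H(3)]
    by (simp_all add: cell_comp_def proj_cell_def flip: comp)
  then show "tightL K = tightL ?L" "tightR K = tightR ?L" "onStates K = onStates ?L"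
    by (simp_all add: L)
  \<comment> \<open>With the boundaries identified, the components of \<open>K\<close> and of the
    tuple cell have the same target functor and can be compared by extensionality in object, element
    and index.\<close>
  let ?W = "set_prod_fctr E I (\<lambda>i. fctr_comp E (val (T i)) (dom_fctr (H i)))"
  have mem: "component M \<in> (\<Pi>\<^sub>E c\<in>Obj E. onO (val S) c \<rightarrow>\<^sub>E onO ?W c)" if "M = K \<or> M = ?L" for M
    using that K cell_tuple_cell cell_tuple_iff[OF KH] cell_tuple_iff[OF L]
    unfolding set_nat_trans_def by blast
  show "component K = component ?L"
  proof (rule PiE_ext)
    show "component K \<in> (\<Pi>\<^sub>E c\<in>Obj E. onO (val S) c \<rightarrow>\<^sub>E onO ?W c)"
      "component ?L \<in> (\<Pi>\<^sub>E c\<in>Obj E. onO (val S) c \<rightarrow>\<^sub>E onO ?W c)"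
      using mem by blast+
    fix c assume c: "c \<in> Obj E"
    show "component K c = component ?L c"
    proof (rule PiE_ext)
      show K': "component K c \<in> onO (val S) c \<rightarrow>\<^sub>E onO ?W c"
        and L': "component ?L c \<in> onO (val S) c \<rightarrow>\<^sub>E onO ?W c"
        using mem c by (blast dest: PiE_mem)+
      fix x assume x: "x \<in> onO (val S) c"
      show "component K c x = component ?L c x"
      proof (rule PiE_ext)
        show "component K c x \<in> (\<Pi>\<^sub>E i\<in>I. onO (fctr_comp E (val (T i)) (dom_fctr (H i))) c)"
          "component ?L c x \<in> (\<Pi>\<^sub>E i\<in>I. onO (fctr_comp E (val (T i)) (dom_fctr (H i))) c)"
          using PiE_mem[OF K' x] PiE_mem[OF L' x] c by simp_all
        fix i assume "i \<in> I"
        \<comment> \<open>The coordinate at \<open>i\<close> is the component of the composite with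
          the projection, which \<open>comp\<close> identifies with that of
          \<open>H i\<close>.\<close>
        then show "component K c x i = component ?L c x i"
          using component_cell_comp_proj[OF KH K c x, of i] comp c x
          by (simp add: tuple_cell_def)
      qed
    qed
  qed
qed simp

end

theorem mainTheorem9:
  fixes I :: "'i set"
    and A :: "'i \<Rightarrow> ('ao, 'am) cat"
    and B :: "'i \<Rightarrow> ('bo, 'bm) cat"
    and T :: "'i \<Rightarrow> ('ao, 'am, 'bo, 'bm, 'qo, 'qm, 'x) tdx"
  assumes "\<And>i. i \<in> I \<Longrightarrow> transducer (A i) (B i) (T i)"
  shows "transducer (prod_cat I A) (prod_cat I B) (prod_tdx I A B T) \<and>
    (\<forall>i\<in>I. cell (prod_cat I A) (prod_cat I B) (prod_tdx I A B T) (A i) (B i) (T i)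
              (proj_cell I A B T i) \<and>
            tightL (proj_cell I A B T i) = proj_fctr I A i \<and>
            tightR (proj_cell I A B T i) = proj_fctr I B i) \<and>
    (\<forall>(X :: ('xo, 'xm) cat) (Y :: ('yo, 'ym) cat)
        (S :: ('xo, 'xm, 'yo, 'ym, 'po, 'pm, 'z) tdx) H.
       transducer X Y S \<and> (\<forall>i\<in>I. cell X Y S (A i) (B i) (T i) (H i)) \<longrightarrow>
       (\<exists>!K. cell X Y S (prod_cat I A) (prod_cat I B) (prod_tdx I A B T) K \<and>
             (\<forall>i\<in>I. cell_comp X Y S (proj_cell I A B T i) K = H i)))"
proof (intro conjI ballI allI impI)
  interpret tdx_family I A B T
    using assms by unfold_locales
  show "transducer (prod_cat I A) (prod_cat I B) (prod_tdx I A B T)"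
    by (rule transducer_prod_tdx)
  fix i assume "i \<in> I"
  then show "cell (prod_cat I A) (prod_cat I B) (prod_tdx I A B T) (A i) (B i) (T i)
      (proj_cell I A B T i)"
    by (rule cell_proj_cell)
  show "tightL (proj_cell I A B T i) = proj_fctr I A i"
    "tightR (proj_cell I A B T i) = proj_fctr I B i"
    by (simp_all add: proj_cell_def)
next
  fix X :: "('xo, 'xm) cat" and Y :: "('yo, 'ym) cat"
    and S :: "('xo, 'xm, 'yo, 'ym, 'po, 'pm, 'z) tdx" and H
  assume "transducer X Y S \<and> (\<forall>i\<in>I. cell X Y S (A i) (B i) (T i) (H i))"
  then interpret tdx_cone I A B T X Y S H
    using assms by unfold_locales auto
  show "\<exists>!K. cell X Y S (prod_cat I A) (prod_cat I B) (prod_tdx I A B T) K \<and>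
      (\<forall>i\<in>I. cell_comp X Y S (proj_cell I A B T i) K = H i)"
    using cell_tuple_cell proj_cell_comp_tuple_cell tuple_cell_unique by blast
qed

end
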